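(* Let $\mathcal X,\mathcal Y$ be finite sets. There exists a sequence of channels $\{U^n_{Y^n|X^n}\}_{n\in\mathbb N}$ with $U^n_{Y^n|X^n}\in\mathcal P^{\rm sym}(\mathcal Y^n|\mathcal X^n)$ such that, for every $n\in\mathbb N$, every $Q_{Y^n|X^n}\in\mathcal P^{\rm sym}(\mathcal Y^n|\mathcal X^n)$ and every $P_{X^n}\in\mathcal P(\mathcal X^n)$, $$(P_{X^n}\times Q_{Y^n|X^n})(x^n,y^n)\le|\mathcal T_n(\mathcal X\times\mathcal Y)|\,(P_{X^n}\times U^n_{Y^n|X^n})(x^n,y^n)\qquad\text{for all }x^n\in\mathcal X^n,\ y^n\in\mathcal Y^n.$$
   Context: $\mathcal P(\mathcal X^n)$ is the set of probability mass functions on $\mathcal X^n$. $\mathcal P^{\rm sym}(\mathcal Y^n|\mathcal X^n)$ is the set of permutation covariant channels (conditional distributions $Q_{Y^n|X^n}(y^n|x^n)$ from $\mathcal X^n$ to $\mathcal Y^n$), i.e. those with $Q_{Y^n|X^n}(y_{\pi(1)},\dots,y_{\pi(n)}|x_{\pi(1)},\dots,x_{\pi(n)})=Q_{Y^n|X^n}(y_1,\dots,y_n|x_1,\dots,x_n)$ for all permutations $\pi\in S_n$ and all $x^n,y^n$. $(P_{X^n}\times Q_{Y^n|X^n})(x^n,y^n)=P_{X^n}(x^n)Q_{Y^n|X^n}(y^n|x^n)$. $\mathcal T_n(\mathcal X\times\mathcal Y)$ is the set of types of length $n$ over $\mathcal X\times\mathcal Y$, i.e. of empirical distributions of sequences in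 $(\mathcal X\times\mathcal Y)^n$. *)

theory Defs
  imports
    "HOL-Probability.Probability"
    "HOL-Combinatorics.Permutations"
    "HOL-Library.NList"
begin

text \<open>
  Sequences in \<open>A\<^sup>n\<close> are the lists in \<^term>\<open>nlists n A\<close>. Positions are counted from 0, so a
  permutation in \<open>S\<^sub>n\<close> is a function that permutes \<^term>\<open>{..<n}\<close>, and
  \<^term>\<open>permute_list \<pi> xs\<close> is the list whose \<open>i\<close>-th entry is the \<open>\<pi> i\<close>-th entry of \<open>xs\<close>.
\<close>

definition pmfs_on :: "'a set \<Rightarrow> 'a pmf set" where
  "pmfs_on A = {P. set_pmf P \<subseteq> A}"

text \<open>A channel is a total function; its values outside the input set are irrelevant.\<close>

definition channels :: "'a set \<Rightarrow> 'b set \<Rightarrow> ('a \<Rightarrow> 'b pmf) set" where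
  "channels A B = {Q. \<forall>x\<in>A. Q x \<in> pmfs_on B}"

definition sym_channels ::
    "nat \<Rightarrow> 'a set \<Rightarrow> 'b set \<Rightarrow> ('a list \<Rightarrow> 'b list pmf) set" where
  "sym_channels n X Y =
    {Q \<in> channels (nlists n X) (nlists n Y).
      \<forall>\<pi>. \<pi> permutes {..<n} \<longrightarrow>
        (\<forall>x\<in>nlists n X. \<forall>y\<in>nlists n Y.
          pmf (Q (permute_list \<pi> x)) (permute_list \<pi> y) = pmf (Q x) y)}"

definition joint :: "'a pmf \<Rightarrow> ('a \<Rightarrow> 'b pmf) \<Rightarrow> 'a \<Rightarrow> 'b \<Rightarrow> real" where
  "joint P Q x y = pmf P x * pmf (Q x) y"

definition empirical :: "'a list \<Rightarrow> 'a pmf" where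
  "empirical zs = pmf_of_multiset (mset zs)"

lemma pmf_empirical:
  assumes "zs \<noteq> []"
  shows "pmf (empirical zs) a = real (count_list zs a) / real (length zs)"
  using assms by (simp add: empirical_def count_mset)

text \<open>
  For \<open>n = 0\<close> the only sequence is the empty one; its empirical distribution is unspecified,
  but \<^term>\<open>types 0 A\<close> is a singleton in any case.
\<close>

definition types :: "nat \<Rightarrow> 'a set \<Rightarrow> 'a pmf set" where
  "types n A = empirical ` nlists n A"

end

theory Submission
  imports Defs
begin

text \<open>
  The channel \<open>U\<^sup>n\<close>, on input \<open>x\<close>, first draws uniformly a joint type compatible with \<open>x\<close> and then
  draws \<open>y\<close> uniformly from the sequences having that joint type with \<open>x\<close>. A permutation covariant
  channel \<open>Q\<close> is constant on each such conditional type class, so \<open>Q(y|x)\<close> is at most the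
  reciprocal of the size of the class of \<open>y\<close>, which exceeds \<open>U\<^sup>n(y|x)\<close> by a factor equal to the
  number of compatible joint types.
\<close>

section \<open>Types and multisets of entries\<close>

lemma empirical_eq_iff:
  assumes "length xs = length ys"
  shows "empirical xs = empirical ys \<longleftrightarrow> mset xs = mset ys"
proof (cases "xs = []")
  case False
  show ?thesis
  proof
    assume eq: "empirical xs = empirical ys"
    have "count (mset xs) a = count (mset ys) a" for a
    proof -
      \<comment> \<open>The common nonzero length makes the denominators cancel, so the frequencies
        determine the counts.\<close>
      have "real (count_list xs a) / real (length xs) = real (count_list ys a) / real (length ys)"
        using pmf_empirical[of xs a] pmf_empirical[of ys a] eq False assms by auto
      then show ?thesis
        using False assms by (auto simp: count_mset)
    qed
    then show "mset xs = mset ys"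
      by (rule multiset_eqI)
  qed (simp add: empirical_def)
qed (use assms in simp)

text \<open>Joint types are represented by multisets of pairs.\<close>

definition joint_types :: "nat \<Rightarrow> 'b set \<Rightarrow> 'a list \<Rightarrow> ('a \<times> 'b) multiset set" where
  "joint_types n Y x = (\<lambda>y. mset (zip x y)) ` nlists n Y"

text \<open>Membership in \<open>nlists n Y\<close> fixes the length of \<open>y\<close>; the
  multiset alone would not, because \<open>zip\<close> truncates.\<close>

definition cond_type_class :: "nat \<Rightarrow> 'b set \<Rightarrow> 'a list \<Rightarrow> ('a \<times> 'b) multiset \<Rightarrow> 'b list set" where
  "cond_type_class n Y x m = {y \<in> nlists n Y. mset (zip x y) = m}"

definition universal_channel :: "nat \<Rightarrow> 'b set \<Rightarrow> 'a list \<Rightarrow> 'b list pmf" where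
  "universal_channel n Y x =
    bind_pmf (pmf_of_set (joint_types n Y x)) (\<lambda>m. pmf_of_set (cond_type_class n Y x m))"

section \<open>Support and probabilities of the universal channel\<close>

lemma finite_nlists: "finite A \<Longrightarrow> finite (nlists n A)"
  unfolding nlists_def using finite_lists_length_eq[of A n] by (metis (no_types, lifting) Collect_cong)

lemma nlists_nonempty: "n = 0 \<or> A \<noteq> {} \<Longrightarrow> nlists n A \<noteq> {}"
  using nlists_not_empty[of A n] by auto

lemma finite_joint_types: "finite Y \<Longrightarrow> finite (joint_types n Y x)"
  by (simp add: joint_types_def finite_nlists)

lemma joint_types_nonempty: "nlists n Y \<noteq> {} \<Longrightarrow> joint_types n Y x \<noteq> {}"
  by (simp add: joint_types_def)

lemma finite_cond_type_class: "finite Y \<Longrightarrow> finite (cond_type_class n Y x m)"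
  by (simp add: cond_type_class_def finite_nlists)

text \<open>\<open>pmf_of_set\<close> is determined only on finite nonempty sets, which is why the
  first draw ranges over the types compatible with \<open>x\<close>.\<close>

lemma cond_type_class_nonempty: "m \<in> joint_types n Y x \<Longrightarrow> cond_type_class n Y x m \<noteq> {}"
  by (auto simp: joint_types_def cond_type_class_def)

lemma set_pmf_universal_channel:
  assumes "finite Y" and "nlists n Y \<noteq> {}"
  shows "set_pmf (universal_channel n Y x) \<subseteq> nlists n Y"
proof -
  have "set_pmf (universal_channel n Y x) =
      (\<Union>m\<in>joint_types n Y x. set_pmf (pmf_of_set (cond_type_class n Y x m)))"
    using assms by (simp add: universal_channel_def finite_joint_types joint_types_nonempty)
  also have "\<dots> = (\<Union>m\<in>joint_types n Y x. cond_type_class n Y x m)"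
    using assms(1) by (intro SUP_cong set_pmf_of_set)
      (simp_all add: cond_type_class_nonempty finite_cond_type_class)
  finally show ?thesis
    by (auto simp: cond_type_class_def)
qed

text \<open>Classes of distinct joint types are disjoint, so only the type of \<open>y\<close>
  itself contributes to the mixture.\<close>

lemma pmf_universal_channel:
  assumes "finite Y" and y: "y \<in> nlists n Y"
  shows "pmf (universal_channel n Y x) y =
    1 / (real (card (joint_types n Y x)) * real (card (cond_type_class n Y x (mset (zip x y)))))"
proof -
  let ?K = "joint_types n Y x" and ?C = "cond_type_class n Y x" and ?t = "mset (zip x y)"
  have K: "finite ?K" "?K \<noteq> {}" and t: "?t \<in> ?K"
    using assms finite_joint_types joint_types_nonempty by (auto simp: joint_types_def)
  have "pmf (universal_channel n Y x) y = (\<Sum>m\<in>?K. pmf (pmf_of_set (?C m)) y) / real (card ?K)"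
    using K by (simp add: universal_channel_def pmf_bind_pmf_of_set)
  also have "(\<Sum>m\<in>?K. pmf (pmf_of_set (?C m)) y) =
      (\<Sum>m\<in>?K. if m = ?t then 1 / real (card (?C ?t)) else 0)"
  proof (rule sum.cong)
    fix m assume m: "m \<in> ?K"
    have "pmf (pmf_of_set (?C m)) y = indicator (?C m) y / real (card (?C m))"
      by (rule pmf_of_set[OF cond_type_class_nonempty[OF m] finite_cond_type_class[OF assms(1)]])
    moreover have "y \<in> ?C m \<longleftrightarrow> m = ?t"
      using y by (auto simp: cond_type_class_def)
    ultimately show "pmf (pmf_of_set (?C m)) y = (if m = ?t then 1 / real (card (?C ?t)) else 0)"
      by (simp add: indicator_def)
  qed simp
  also have "\<dots> = 1 / real (card (?C ?t))"
    using K t by simp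
  finally show ?thesis by simp
qed

section \<open>Covariance of the universal channel\<close>

lemma permute_list_in_nlists:
  assumes "\<pi> permutes {..<n}" and y: "y \<in> nlists n A"
  shows "permute_list \<pi> y \<in> nlists n A"
proof (rule nlistsI)
  have len: "length y = n"
    using y by (rule nlistsE_length)
  then show "length (permute_list \<pi> y) = n"
    by simp
  have "set (permute_list \<pi> y) = set y"
    using assms(1) unfolding len[symmetric] by (rule set_permute_list)
  then show "set (permute_list \<pi> y) \<subseteq> A"
    using nlistsE_set[OF y] by simp
qed

text \<open>Rearranging both lists by the same \<pi> merely rearranges the list of pairs.\<close>

lemma mset_zip_permute_list:
  assumes \<pi>: "\<pi> permutes {..<n}" and x: "length x = n" and y: "length y = n"
  shows "mset (zip (permute_list \<pi> x) (permute_list \<pi> y)) = mset (zip x y)"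
proof -
  have "zip (permute_list \<pi> x) (permute_list \<pi> y) = permute_list \<pi> (zip x y)"
    by (rule permute_list_zip[OF \<pi>, symmetric]) (simp_all add: x y)
  moreover have "\<pi> permutes {..<length (zip x y)}"
    using \<pi> by (simp add: x y)
  ultimately show ?thesis
    by (simp only: mset_permute_list)
qed

lemma permute_list_inv:
  assumes \<pi>: "\<pi> permutes {..<length y}"
  shows "permute_list \<pi> (permute_list (inv \<pi>) y) = y"
    and "permute_list (inv \<pi>) (permute_list \<pi> y) = y"
  \<comment> \<open>\<open>permute_list\<close> reverses the order of composition: the first claim
    reduces to \<open>inv \<pi> \<circ> \<pi>\<close>, the second to
    \<open>\<pi> \<circ> inv \<pi>\<close>.\<close>
  unfolding permute_list_compose[OF \<pi>, symmetric]
    permute_list_compose[OF permutes_inv[OF \<pi>], symmetric] permutes_inv_o[OF \<pi>]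
  by (rule permute_list_id)+

text \<open>This justifies the substitution of \<open>permute_list \<pi> y\<close> for
  \<open>y\<close> in sets indexed by all outputs.\<close>

lemma bij_betw_permute_list:
  assumes \<pi>: "\<pi> permutes {..<n}"
  shows "bij_betw (permute_list \<pi>) (nlists n A) (nlists n A)"
proof (rule bij_betw_byWitness[where f' = "permute_list (inv \<pi>)"])
  have \<pi>': "\<pi> permutes {..<length y}" if "y \<in> nlists n A" for y :: "'a list"
    using \<pi> unfolding nlistsE_length[OF that] .
  show "\<forall>y\<in>nlists n A. permute_list (inv \<pi>) (permute_list \<pi> y) = y"
    "\<forall>y\<in>nlists n A. permute_list \<pi> (permute_list (inv \<pi>) y) = y"
    using permute_list_inv[OF \<pi>'] by blast+
  show "permute_list \<pi> ` nlists n A \<subseteq> nlists n A"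
    "permute_list (inv \<pi>) ` nlists n A \<subseteq> nlists n A"
    using permute_list_in_nlists[OF \<pi>] permute_list_in_nlists[OF permutes_inv[OF \<pi>]] by blast+
qed

text \<open>After that substitution both arguments of \<open>zip\<close> are permuted alike, which
  leaves each multiset of pairs unchanged.\<close>

lemma joint_types_permute_list:
  assumes \<pi>: "\<pi> permutes {..<n}" and x: "length x = n"
  shows "joint_types n Y (permute_list \<pi> x) = joint_types n Y x"
proof -
  have "joint_types n Y (permute_list \<pi> x) =
      (\<lambda>y. mset (zip (permute_list \<pi> x) y)) ` permute_list \<pi> ` nlists n Y"
    by (simp only: joint_types_def bij_betw_imp_surj_on[OF bij_betw_permute_list[OF \<pi>]])
  also have "\<dots> = joint_types n Y x"
    unfolding joint_types_def image_image
    by (rule image_cong[OF refl], rule mset_zip_permute_list[OF \<pi> x], rule nlistsE_length)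
  finally show ?thesis .
qed

text \<open>Unlike the set of joint types, a class may move with the input. It moves by an
  injection, so its size, on which the uniform weights depend, is preserved.\<close>

lemma cond_type_class_permute_list:
  assumes \<pi>: "\<pi> permutes {..<n}" and x: "length x = n"
  shows "cond_type_class n Y (permute_list \<pi> x) m = permute_list \<pi> ` cond_type_class n Y x m"
proof -
  have "cond_type_class n Y (permute_list \<pi> x) m =
      {y \<in> permute_list \<pi> ` nlists n Y. mset (zip (permute_list \<pi> x) y) = m}"
    by (simp only: cond_type_class_def bij_betw_imp_surj_on[OF bij_betw_permute_list[OF \<pi>]])
  also have "\<dots> = permute_list \<pi> ` {y \<in> nlists n Y.
      mset (zip (permute_list \<pi> x) (permute_list \<pi> y)) = m}"
    by blast
  also have "{y \<in> nlists n Y. mset (zip (permute_list \<pi> x) (permute_list \<pi> y)) = m} =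
      cond_type_class n Y x m"
    unfolding cond_type_class_def
    using mset_zip_permute_list[OF \<pi> x nlistsE_length] by (metis (lifting))
  finally show ?thesis .
qed

lemma card_cond_type_class_permute_list:
  assumes "\<pi> permutes {..<n}" and "length x = n"
  shows "card (cond_type_class n Y (permute_list \<pi> x) m) = card (cond_type_class n Y x m)"
  unfolding cond_type_class_permute_list[OF assms]
  by (rule card_image, rule inj_on_subset,
      rule bij_betw_imp_inj_on[OF bij_betw_permute_list[OF assms(1)]])
    (unfold cond_type_class_def, rule Collect_subset)

text \<open>The formula for the probabilities involves only two cardinalities, both invariant under
  joint permutation. The condition on \<open>X\<close> and \<open>Y\<close> ensures that every input
  has a possible output.\<close>

lemma universal_channel_sym:
  assumes "finite Y" and "X \<noteq> {} \<Longrightarrow> Y \<noteq> {}"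
  shows "universal_channel n Y \<in> sym_channels n X Y"
proof -
  have "nlists n Y \<noteq> {}" if "x \<in> nlists n X" for x
  proof (rule nlists_nonempty)
    \<comment> \<open>An input of positive length has an entry in \<open>X\<close>, which forces
      \<open>Y\<close> to be nonempty; for \<open>n = 0\<close> the empty list is an output.\<close>
    show "n = 0 \<or> Y \<noteq> {}"
      using that assms(2) by (cases n) (auto simp: in_nlists_Suc_iff)
  qed
  then have "universal_channel n Y \<in> channels (nlists n X) (nlists n Y)"
    using set_pmf_universal_channel[OF assms(1)] by (auto simp: channels_def pmfs_on_def)
  moreover have "pmf (universal_channel n Y (permute_list \<pi> x)) (permute_list \<pi> y) =
      pmf (universal_channel n Y x) y"
    if "\<pi> permutes {..<n}" "x \<in> nlists n X" "y \<in> nlists n Y" for \<pi> x y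
  proof -
    have len: "length x = n" "length y = n"
      using that by (auto dest: nlistsE_length)
    show ?thesis
      unfolding pmf_universal_channel[OF assms(1) that(3)]
        pmf_universal_channel[OF assms(1) permute_list_in_nlists[OF that(1,3)]]
        joint_types_permute_list[OF that(1) len(1)]
        mset_zip_permute_list[OF that(1) len]
        card_cond_type_class_permute_list[OF that(1) len(1)] ..
  qed
  ultimately show ?thesis
    by (simp add: sym_channels_def)
qed

section \<open>Domination of every covariant channel\<close>

lemma card_joint_types_le:
  assumes "finite X" and "finite Y" and x: "x \<in> nlists n X"
  shows "card (joint_types n Y x) \<le> card (types n (X \<times> Y))"
proof -
  have zip: "zip x y \<in> nlists n (X \<times> Y)" if y: "y \<in> nlists n Y" for y
  proof (rule nlistsI)
    show "length (zip x y) = n"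
      using x y by simp
    show "set (zip x y) \<subseteq> X \<times> Y"
      using nlistsE_set[OF x] nlistsE_set[OF y] by (auto dest: set_zip_leftD set_zip_rightD)
  qed
  \<comment> \<open>Pairing with the fixed \<open>x\<close> turns outputs into sequences over
    \<open>X \<times> Y\<close>, so compatible types are among all multisets of such
    sequences.\<close>
  have "joint_types n Y x = mset ` zip x ` nlists n Y"
    by (simp add: joint_types_def image_image)
  also have "\<dots> \<subseteq> mset ` nlists n (X \<times> Y)"
    using zip by blast
  finally have "card (joint_types n Y x) \<le> card (mset ` nlists n (X \<times> Y))"
    using assms by (intro card_mono) (auto simp: finite_nlists)
  also have "\<dots> = card (types n (X \<times> Y))"
  proof -
    \<comment> \<open>All these multisets have size \<open>n\<close>, so by
      \<open>empirical_eq_iff\<close> normalizing them loses no information; for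
      \<open>n = 0\<close> both sides are singletons.\<close>
    have "bij_betw pmf_of_multiset (mset ` nlists n (X \<times> Y)) (types n (X \<times> Y))"
      unfolding bij_betw_def types_def
      by (auto simp: inj_on_def image_image empirical_def[symmetric] empirical_eq_iff)
    then show ?thesis
      by (rule bij_betw_same_card)
  qed
  finally show ?thesis .
qed

text \<open>Equal multisets of pairs differ by a permutation of positions. Its first components show
  that it fixes \<open>x\<close>, its second that it sends \<open>y\<close> to \<open>y'\<close>, so
  covariance compares the two outputs at the same input.\<close>

lemma sym_channel_constant_on_class:
  assumes Q: "Q \<in> sym_channels n X Y" and x: "x \<in> nlists n X"
    and y: "y \<in> nlists n Y" "y' \<in> nlists n Y" and eq: "mset (zip x y') = mset (zip x y)"
  shows "pmf (Q x) y' = pmf (Q x) y"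
proof -
  have len: "length x = n" "length y = n" "length y' = n"
    using x y by (auto dest: nlistsE_length)
  obtain \<pi> where \<pi>: "\<pi> permutes {..<n}" "permute_list \<pi> (zip x y) = zip x y'"
    using mset_eq_permutation[OF eq] len by auto
  then have "zip (permute_list \<pi> x) (permute_list \<pi> y) = zip x y'"
    using len by (simp add: permute_list_zip)
  then have "permute_list \<pi> x = x" "permute_list \<pi> y = y'"
    using len by (metis length_permute_list map_fst_zip, metis length_permute_list map_snd_zip)
  moreover have "pmf (Q (permute_list \<pi> x)) (permute_list \<pi> y) = pmf (Q x) y"
    using Q x y(1) \<pi>(1) by (simp add: sym_channels_def)
  ultimately show ?thesis
    by simp
qed

lemma sym_channel_le_universal:
  assumes fin: "finite X" "finite Y" and Q: "Q \<in> sym_channels n X Y"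
    and x: "x \<in> nlists n X" and y: "y \<in> nlists n Y"
  shows "pmf (Q x) y \<le> real (card (types n (X \<times> Y))) * pmf (universal_channel n Y x) y"
proof -
  let ?C = "cond_type_class n Y x (mset (zip x y))" and ?K = "joint_types n Y x"
  have finC: "finite ?C" and C: "y \<in> ?C"
    using fin(2) y by (auto simp: finite_cond_type_class) (simp add: cond_type_class_def)
  have cpos: "real (card ?C) > 0"
    using finC C by (auto simp: card_gt_0_iff)
  have "mset (zip x y) \<in> ?K"
    using y by (auto simp: joint_types_def)
  then have kpos: "real (card ?K) > 0"
    using finite_joint_types[OF fin(2)] by (auto simp: card_gt_0_iff)
  \<comment> \<open>All members of the class are equally likely under \<open>Q x\<close>, and
    together they have probability at most one.\<close>
  have "real (card ?C) * pmf (Q x) y = (\<Sum>y'\<in>?C. pmf (Q x) y')"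
    using sym_channel_constant_on_class[OF Q x y] by (simp add: cond_type_class_def)
  also have "\<dots> = measure (measure_pmf (Q x)) ?C"
    using finC by (simp add: measure_measure_pmf_finite)
  also have "\<dots> \<le> 1"
    by simp
  finally have "pmf (Q x) y \<le> 1 / real (card ?C)"
    using cpos by (simp add: field_simps)
  \<comment> \<open>The explicit formula for the universal channel, solved for the reciprocal of the
    class size.\<close>
  also have "\<dots> = real (card ?K) * pmf (universal_channel n Y x) y"
    using kpos by (simp add: pmf_universal_channel[OF fin(2) y])
  \<comment> \<open>The number of compatible types depends on \<open>x\<close>; the number of all
    joint types is a bound uniform in \<open>x\<close>.\<close>
  also have "\<dots> \<le> real (card (types n (X \<times> Y))) * pmf (universal_channel n Y x) y"
    using card_joint_types_le[OF fin x] by (intro mult_right_mono) auto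
  finally show ?thesis .
qed

theorem lemma17:
  fixes X :: "'a set" and Y :: "'b set"
  assumes "finite X" and "finite Y"
    and "X \<noteq> {} \<Longrightarrow> Y \<noteq> {}"
  shows "\<exists>U :: nat \<Rightarrow> 'a list \<Rightarrow> 'b list pmf.
    (\<forall>n. U n \<in> sym_channels n X Y) \<and>
    (\<forall>n. \<forall>Q \<in> sym_channels n X Y. \<forall>P \<in> pmfs_on (nlists n X).
      \<forall>x \<in> nlists n X. \<forall>y \<in> nlists n Y.
        joint P Q x y \<le> real (card (types n (X \<times> Y))) * joint P (U n) x y)"
proof (intro exI[of _ "\<lambda>n. universal_channel n Y"] conjI allI ballI)
  show "universal_channel n Y \<in> sym_channels n X Y" for n
    using assms(2,3) by (rule universal_channel_sym)
next
  fix n Q P x y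
  assume "Q \<in> sym_channels n X Y" "x \<in> nlists n X" "y \<in> nlists n Y"
  \<comment> \<open>The input probability is a common nonnegative factor, so a pointwise bound
    between the channels settles all \<open>P\<close> at once.\<close>
  then have "pmf P x * pmf (Q x) y \<le>
      pmf P x * (real (card (types n (X \<times> Y))) * pmf (universal_channel n Y x) y)"
    using assms(1,2) by (intro mult_left_mono sym_channel_le_universal) auto
  then show "joint P Q x y \<le>
      real (card (types n (X \<times> Y))) * joint P (universal_channel n Y) x y"
    by (simp add: joint_def mult.left_commute)
qed

end
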